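(* Consider the box-ball system with variable box capacities $\Delta_n$ and no restriction on the carrier capacity, whose state at time $t$ has $N\ge 1$ solitons. With $Q^{(t)}_n$ the size of the $n$th soliton, $E^{(t)}_n$ the size of the $n$th empty block, $D^{(t+1)}_n$ the number of balls held by the carrier just after getting the $Q^{(t)}_n$ balls of the $n$th soliton, and $\Lambda^{(t)}_n$ the capacity of the box containing the leftmost segment of the $n$th empty block (all as defined in the context), the time evolution of the box-ball system from time $t$ to time $t+1$ is given by $$Q^{(t+1)}_n=\min\left(E^{(t)}_{n+1}-\max(0,\Lambda^{(t)}_{n+1}-D^{(t+1)}_n),\ D^{(t+1)}_n\right),\qquad 0\le n\le N-1,$$ $$E^{(t+1)}_n=E^{(t)}_n-Q^{(t+1)}_{n-1}+Q^{(t)}_n-\max(0,\Lambda^{(t)}_n-D^{(t+1)}_{n-1})+\max(0,\Lambda^{(t)}_{n+1}-D^{(t+1)}_n),\qquad 1\le n\le N-1,$$ $$D^{(t+1)}_n=D^{(t+1)}_{n-1}-Q^{(t+1)}_{n-1}+Q^{(t)}_n,\qquad 1\le n\le N-1,$$ $$E^{(t)}_0=E^{(t)}_N=+\infty,\qquad D^{(t+1)}_0=Q^{(t)}_0.$$ That is, the state at time $t+1$ again has $N$ solitons, and its soliton sizes $Q^{(t+1)}_n$ ($0\le n\le N-1$) and empty block sizes $E^{(t+1)}_n$ ($1\le n\le N-1$), together with the carrier quantities $D^{(t+1)}_n$, satisfy these equations.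
   Context: **Box-ball system.** Boxes are indexed by $n\in\mathbb Z$; the $n$th box has capacity $\Delta_n$, a positive integer. A state at time $t$ is a sequence $(U^{(t)}_n)_{n\in\mathbb Z}$ with $U^{(t)}_n\in\{0,1,\dots,\Delta_n\}$ (the number of balls in the $n$th box at time $t$); there are finitely many balls, and $U^{(t)}_n=0$ for $n<0$. The time evolution is $$U^{(t+1)}_n=\min\left(\Delta_n-U^{(t)}_n,\ \sum_{j=-\infty}^{n-1}(U^{(t)}_j-U^{(t+1)}_j)\right).$$ Equivalently, a carrier moves from left to right; at each box it gets all balls in the box and at the same time puts as many as possible of the balls it was carrying on arrival into the box (at most $\Delta_n-U^{(t)}_n$). The number of balls it carries on arrival at the $n$th box is $\sum_{j<n}(U^{(t)}_j-U^{(t+1)}_j)$. **Expansion map.** Let $s_0=0$ and $s_n=\sum_{j=0}^{n-1}\Delta_j$ for $n\ge1$. A state $(U^{(t)}_n)$ is mapped to a binary sequence $(V^{(t)}_j)_{j\in\mathbb Z}$, $V^{(t)}_j\in\{0,1\}$, as follows. Set $V^{(t)}_j=0$ for $j<0$. Then, for $n=0,1,2,\dots$ successively: if $V^{(t)}_{s_n-1}=1$, set $V^{(t)}_j=1$ for $s_n\le j\le s_n+U^{(t)}_n-1$ and $V^{(t)}_j=0$ for $s_n+U^{(t)}_n\le j\le s_n+\Delta_n-1$; otherwise set $V^{(t)}_j=0$ for $s_n\le j\le s_n+\Delta_n-U^{(t)}_n-1$ and $V^{(t)}_j=1$ for $s_n+\Delta_n-U^{(t)}_n\le j\le s_n+\Delta_n-1$.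 The entry $V^{(t)}_j$ is called the $j$th segment; the $n$th box ($n\ge 0$) contains the segments $s_n,\dots,s_n+\Delta_n-1$. **Solitons and empty blocks.** The solitons at time $t$ are the maximal runs of consecutive $1$s of $V^{(t)}$, numbered $0,1,\dots,N-1$ from left to right; $Q^{(t)}_n$ is the length of the $n$th one. For $1\le n\le N-1$, the $n$th empty block is the run of $0$s between the $(n-1)$th and the $n$th soliton, and $E^{(t)}_n$ is its length. The $0$th and $N$th empty blocks are the infinite runs of $0$s to the left of the $0$th soliton and to the right of the $(N-1)$th soliton; by convention $E^{(t)}_0=E^{(t)}_N=+\infty$. **Further quantities.** For $1\le n\le N$, $\Lambda^{(t)}_n$ is the capacity of the box which contains the leftmost segment of the $n$th empty block at time $t$. For $0\le n\le N-1$, $D^{(t+1)}_n$ is the number of balls which the carrier holds after getting the $Q^{(t)}_n$ balls of the $n$th soliton: if $m$ is the index of the box containing the leftmost segment of the $(n+1)$th empty block at time $t$, then $$D^{(t+1)}_n=\sum_{j=-\infty}^{m-1}(U^{(t)}_j-U^{(t+1)}_j)+U^{(t)}_m.$$ *)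

theory Defs
  imports "HOL-Library.Extended_Real"
begin

text \<open>Boxes are indexed by integers; \<open>\<Delta> n\<close> is the capacity of box \<open>n\<close> and \<open>U n\<close> the number of
  balls in it.  All quantities are integer-valued, so that subtraction is never truncated.\<close>

definition bbs_state :: "(int \<Rightarrow> int) \<Rightarrow> (int \<Rightarrow> int) \<Rightarrow> bool" where
  "bbs_state \<Delta> U \<longleftrightarrow>
     (\<forall>n. 0 \<le> U n \<and> U n \<le> \<Delta> n) \<and> finite {n. U n \<noteq> 0} \<and> (\<forall>n<0. U n = 0)"

text \<open>One time step.  The sum is over all boxes \<open>j < n\<close>: boxes with negative index are empty
  before and after the step, so starting it at \<open>0\<close> loses nothing (see \<open>evolve_eq\<close>).\<close>

function evolve :: "(int \<Rightarrow> int) \<Rightarrow> (int \<Rightarrow> int) \<Rightarrow> int \<Rightarrow> int" where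
  "evolve \<Delta> U n =
     (if n < 0 then 0 else min (\<Delta> n - U n) (\<Sum>j\<in>{0..<n}. U j - evolve \<Delta> U j))"
  by auto
termination
  by (relation "measure (\<lambda>(\<Delta>, U, n). nat n)") auto

declare evolve.simps [simp del]

definition carried :: "(int \<Rightarrow> int) \<Rightarrow> (int \<Rightarrow> int) \<Rightarrow> int \<Rightarrow> int" where
  "carried \<Delta> U n = (\<Sum>j\<in>{0..<n}. U j - evolve \<Delta> U j)"

definition offset :: "(int \<Rightarrow> int) \<Rightarrow> int \<Rightarrow> int" where
  "offset \<Delta> n = (\<Sum>j\<in>{0..<n}. \<Delta> j)"

text \<open>Binary sequences are of type \<open>int \<Rightarrow> bool\<close>, with \<open>True\<close> for 1 and \<open>False\<close> for 0.
  \<open>expand_boxes \<Delta> U k\<close> is the sequence after boxes \<open>0, \<dots>, k - 1\<close> have been filled in; the entries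
  from \<open>offset \<Delta> k\<close> on are still \<open>False\<close>.\<close>

primrec expand_boxes :: "(int \<Rightarrow> int) \<Rightarrow> (int \<Rightarrow> int) \<Rightarrow> nat \<Rightarrow> int \<Rightarrow> bool" where
  "expand_boxes \<Delta> U 0 = (\<lambda>j. False)"
| "expand_boxes \<Delta> U (Suc k) =
     (let n = int k; s = offset \<Delta> n; V = expand_boxes \<Delta> U k in
      (\<lambda>j. if s \<le> j \<and> j < s + \<Delta> n
          then (if V (s - 1) then j < s + U n else s + \<Delta> n - U n \<le> j)
          else V j))"

text \<open>As all capacities are positive, segment \<open>j \<ge> 0\<close> lies in one of the boxes \<open>0, \<dots>, j\<close>.
  \<open>expand_spec\<close> below states the box-by-box characterisation.\<close>

definition expand :: "(int \<Rightarrow> int) \<Rightarrow> (int \<Rightarrow> int) \<Rightarrow> int \<Rightarrow> bool" where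
  "expand \<Delta> U j = expand_boxes \<Delta> U (nat (j + 1)) j"

definition box_of :: "(int \<Rightarrow> int) \<Rightarrow> int \<Rightarrow> int" where
  "box_of \<Delta> j = (THE n. 0 \<le> n \<and> offset \<Delta> n \<le> j \<and> j < offset \<Delta> n + \<Delta> n)"

definition solitons :: "(int \<Rightarrow> bool) \<Rightarrow> int set set" where
  "solitons V = {{a..b} | a b. a \<le> b \<and> (\<forall>j\<in>{a..b}. V j) \<and> \<not> V (a - 1) \<and> \<not> V (b + 1)}"

text \<open>Numbering from left to right, from 0: exactly \<open>n\<close> solitons lie to the left of the \<open>n\<close>th.\<close>

definition soliton :: "(int \<Rightarrow> bool) \<Rightarrow> nat \<Rightarrow> int set" where
  "soliton V n = (THE S. S \<in> solitons V \<and> card {T \<in> solitons V. Min T < Min S} = n)"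

text \<open>Position set of the \<open>n\<close>th empty block, meant for \<open>n \<le> card (solitons V)\<close>: the block is
  bounded on the left by soliton \<open>n - 1\<close> and on the right by soliton \<open>n\<close>, whenever these exist.\<close>

definition empty_block :: "(int \<Rightarrow> bool) \<Rightarrow> nat \<Rightarrow> int set" where
  "empty_block V n =
     {j. (0 < n \<longrightarrow> Max (soliton V (n - 1)) < j) \<and>
         (n < card (solitons V) \<longrightarrow> j < Min (soliton V n))}"

definition num_solitons :: "(int \<Rightarrow> int) \<Rightarrow> (int \<Rightarrow> int) \<Rightarrow> nat" where
  "num_solitons \<Delta> U = card (solitons (expand \<Delta> U))"

definition soliton_size :: "(int \<Rightarrow> int) \<Rightarrow> (int \<Rightarrow> int) \<Rightarrow> nat \<Rightarrow> int" where
  "soliton_size \<Delta> U n = int (card (soliton (expand \<Delta> U) n))"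

definition empty_size :: "(int \<Rightarrow> int) \<Rightarrow> (int \<Rightarrow> int) \<Rightarrow> nat \<Rightarrow> ereal" where
  "empty_size \<Delta> U n =
     (let B = empty_block (expand \<Delta> U) n in if finite B then ereal (real (card B)) else \<infinity>)"

definition empty_box :: "(int \<Rightarrow> int) \<Rightarrow> (int \<Rightarrow> int) \<Rightarrow> nat \<Rightarrow> int" where
  "empty_box \<Delta> U n = box_of \<Delta> (LEAST j. j \<in> empty_block (expand \<Delta> U) n)"

definition empty_capacity :: "(int \<Rightarrow> int) \<Rightarrow> (int \<Rightarrow> int) \<Rightarrow> nat \<Rightarrow> int" where
  "empty_capacity \<Delta> U n = \<Delta> (empty_box \<Delta> U n)"

text \<open>If \<open>U\<close> is the state at time \<open>t\<close>, this is the quantity written with time index \<open>t + 1\<close>.\<close>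

definition carrier_load :: "(int \<Rightarrow> int) \<Rightarrow> (int \<Rightarrow> int) \<Rightarrow> nat \<Rightarrow> int" where
  "carrier_load \<Delta> U n =
     (let m = empty_box \<Delta> U (n + 1) in carried \<Delta> U m + U m)"

lemma carried_Suc:
  "carried \<Delta> U (int (Suc k)) = carried \<Delta> U (int k) + U (int k) - evolve \<Delta> U (int k)"
proof -
  have "{0..<int (Suc k)} = insert (int k) {0..<int k}" by auto
  then show ?thesis by (simp add: carried_def)
qed

lemma carried_nonneg:
  assumes "bbs_state \<Delta> U"
  shows "0 \<le> carried \<Delta> U (int k)"
proof (induction k)
  case 0
  then show ?case by (simp add: carried_def)
next
  case (Suc k)
  note carried_Suc[of \<Delta> U k]
  moreover have "evolve \<Delta> U (int k) \<le> carried \<Delta> U (int k)"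
    by (subst evolve.simps) (simp add: carried_def)
  moreover have "0 \<le> U (int k)" using assms by (simp add: bbs_state_def)
  ultimately show ?case by simp
qed

lemma evolve_nonneg_index: "0 \<le> n \<Longrightarrow> evolve \<Delta> U n = min (\<Delta> n - U n) (carried \<Delta> U n)"
  by (subst evolve.simps) (simp add: carried_def)

lemma evolve_neg [simp]: "n < 0 \<Longrightarrow> evolve \<Delta> U n = 0"
  by (subst evolve.simps) simp

lemma evolve_eq:
  assumes "bbs_state \<Delta> U" and "a \<le> 0"
  shows "evolve \<Delta> U n = min (\<Delta> n - U n) (\<Sum>j\<in>{a..<n}. U j - evolve \<Delta> U j)"
proof -
  have U0: "U j = 0" if "j < 0" for j using assms(1) that by (simp add: bbs_state_def)
  have eq: "(\<Sum>j\<in>{a..<n}. U j - evolve \<Delta> U j) = carried \<Delta> U n"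
    unfolding carried_def using assms(2) by (intro sum.mono_neutral_right) (auto simp: U0)
  show ?thesis
  proof (cases "n < 0")
    case True
    have "0 \<le> \<Delta> n" using assms(1) unfolding bbs_state_def by (meson order_trans)
    then show ?thesis using True unfolding eq by (simp add: U0 carried_def)
  next
    case False
    then show ?thesis unfolding eq by (simp add: evolve_nonneg_index)
  qed
qed

lemma bbs_state_evolve:
  assumes pos: "\<And>n. 0 < \<Delta> n" and st: "bbs_state \<Delta> U"
  shows "bbs_state \<Delta> (evolve \<Delta> U)"
proof -
  have U: "0 \<le> U n" "U n \<le> \<Delta> n" for n using st by (auto simp: bbs_state_def)
  have c: "0 \<le> carried \<Delta> U n" if "0 \<le> n" for n
    using carried_nonneg[OF st, of "nat n"] that by simp
  have bounds: "0 \<le> evolve \<Delta> U n \<and> evolve \<Delta> U n \<le> \<Delta> n" for n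
    using U[of n] c[of n] pos[of n] by (cases "n < 0") (auto simp: evolve_nonneg_index)
  obtain M where M: "\<And>n. M \<le> n \<Longrightarrow> U (int n) = 0"
  proof -
    have fin: "finite {n. U n \<noteq> 0}" using st by (simp add: bbs_state_def)
    define b where "b = Max {n. U n \<noteq> 0}"
    have b: "n \<le> b" if "U n \<noteq> 0" for n using fin that by (simp add: b_def)
    have "U (int n) = 0" if "nat (b + 1) \<le> n" for n using b[of "int n"] that by linarith
    then show ?thesis using that by blast
  qed
  have dec: "carried \<Delta> U (int (M + i)) \<le> max 0 (carried \<Delta> U (int M) - int i)" for i
  proof (induction i)
    case 0
    then show ?case by simp
  next
    case (Suc i)
    have "carried \<Delta> U (int (Suc (M + i))) =
        carried \<Delta> U (int (M + i)) - min (\<Delta> (int (M + i))) (carried \<Delta> U (int (M + i)))"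
      unfolding carried_Suc using M[of "M + i"] by (simp add: evolve_nonneg_index)
    then show ?case using Suc pos[of "int (M + i)"] by auto
  qed
  define K where "K = M + nat (carried \<Delta> U (int M))"
  have zero: "evolve \<Delta> U n = 0" if "int K \<le> n" for n
  proof -
    define i where "i = nat (n - int M)"
    have i: "n = int (M + i)" "carried \<Delta> U (int M) \<le> int i"
      using that by (auto simp: K_def i_def split: if_splits)
    have "carried \<Delta> U n \<le> 0" using dec[of i] i by simp
    moreover have "0 \<le> n" using i(1) by simp
    ultimately show ?thesis using bounds[of n] by (simp add: evolve_nonneg_index)
  qed
  have "{n. evolve \<Delta> U n \<noteq> 0} \<subseteq> {0..<int K}"
    using zero by (force simp: not_less[symmetric])
  then have "finite {n. evolve \<Delta> U n \<noteq> 0}" using finite_subset by blast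
  then show ?thesis using bounds by (simp add: bbs_state_def)
qed

lemma offset_Suc: "offset \<Delta> (int (Suc k)) = offset \<Delta> (int k) + \<Delta> (int k)"
proof -
  have "{0..<int (Suc k)} = insert (int k) {0..<int k}" by auto
  then show ?thesis by (simp add: offset_def)
qed

lemma offset_mono:
  assumes "\<And>n. 0 < \<Delta> n" and "k \<le> l"
  shows "offset \<Delta> (int k) \<le> offset \<Delta> (int l)"
  using assms(2)
proof (induction l rule: dec_induct)
  case (step l)
  then show ?case using offset_Suc[of \<Delta> l] assms(1)[of "int l"] by linarith
qed simp

lemma offset_ge:
  assumes "\<And>n. 0 < \<Delta> n"
  shows "int k \<le> offset \<Delta> (int k)"
proof (induction k)
  case (Suc k)
  then show ?case using offset_Suc[of \<Delta> k] assms[of "int k"] by linarith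
qed (simp add: offset_def)

lemma expand_boxes_stable:
  assumes "\<And>n. 0 < \<Delta> n" and "k \<le> l" and "j < offset \<Delta> (int k)"
  shows "expand_boxes \<Delta> U l j = expand_boxes \<Delta> U k j"
  using assms(2)
proof (induction l rule: dec_induct)
  case (step l)
  then show ?case
    using offset_mono[of \<Delta>, OF assms(1) step.hyps(1)] assms(3) by (simp add: Let_def)
qed simp

lemma expand_eq:
  assumes pos: "\<And>n. 0 < \<Delta> n" and "j < offset \<Delta> (int k)"
  shows "expand \<Delta> U j = expand_boxes \<Delta> U k j"
proof (cases "nat (j + 1) \<le> k")
  case True
  have "j < offset \<Delta> (int (nat (j + 1)))"
    using offset_ge[of \<Delta> "nat (j + 1)", OF pos] by linarith
  then show ?thesis
    unfolding expand_def using expand_boxes_stable[of \<Delta>, OF pos True] by simp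
next
  case False
  then show ?thesis
    unfolding expand_def using expand_boxes_stable[of \<Delta> k "nat (j + 1)" j U, OF pos _ assms(2)]
    by simp
qed

lemma expand_spec:
  assumes pos: "\<And>n. 0 < \<Delta> n"
  shows "j < 0 \<Longrightarrow> \<not> expand \<Delta> U j"
    and "0 \<le> n \<Longrightarrow> offset \<Delta> n \<le> j \<Longrightarrow> j < offset \<Delta> n + \<Delta> n \<Longrightarrow>
      expand \<Delta> U j \<longleftrightarrow>
        (if expand \<Delta> U (offset \<Delta> n - 1) then j < offset \<Delta> n + U n
         else offset \<Delta> n + \<Delta> n - U n \<le> j)"
proof -
  show "\<not> expand \<Delta> U j" if "j < 0"
    using that by (simp add: expand_def)
  assume n: "0 \<le> n" and j: "offset \<Delta> n \<le> j" "j < offset \<Delta> n + \<Delta> n"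
  define k where "k = nat n"
  have k: "n = int k" using n by (simp add: k_def)
  have 1: "expand \<Delta> U j = expand_boxes \<Delta> U (Suc k) j"
    using j by (intro expand_eq[OF pos]) (simp only: offset_Suc k)
  have 2: "expand \<Delta> U (offset \<Delta> n - 1) = expand_boxes \<Delta> U k (offset \<Delta> n - 1)"
    by (intro expand_eq[OF pos]) (simp add: k)
  show "expand \<Delta> U j \<longleftrightarrow>
        (if expand \<Delta> U (offset \<Delta> n - 1) then j < offset \<Delta> n + U n
         else offset \<Delta> n + \<Delta> n - U n \<le> j)"
    unfolding 1 2 using j by (simp add: Let_def k)
qed

end

theory Submission
  imports Defs
begin

text \<open>Let soliton \<open>n\<close> occupy the segments \<open>[a n, b n)\<close>.  The box \<open>m\<close> containing segment \<open>b n\<close>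
  consists of ones followed by zeros, so \<open>b n = offset m + U m\<close>, and the segment before it is a one.
  The new balls in this box sit at its right end because the new sequence has a zero just before
  box \<open>m\<close>; hence the new soliton starts at \<open>p = b n + max 0 (\<Lambda> - D)\<close>.  From there the carrier fills
  zeros without gaps until it has dropped the \<open>D\<close> balls it held, or until it reaches
  \<open>x = a (n + 1)\<close>.  So soliton \<open>n\<close> of the new state is \<open>[p, min x (p + D))\<close>, and all
  equations follow by comparing end points.\<close>

section \<open>Runs of a binary sequence\<close>

text \<open>Half-open intervals make lengths plain differences and make \<open>b n\<close> the
  leftmost segment of the next empty block. The strict gap \<open>b n < a (Suc n)\<close> makes the
  intervals maximal. Values of \<open>a\<close> and \<open>b\<close> from index \<open>N\<close> on
  are arbitrary.\<close>

definition runs :: "(int \<Rightarrow> bool) \<Rightarrow> nat \<Rightarrow> (nat \<Rightarrow> int) \<Rightarrow> (nat \<Rightarrow> int) \<Rightarrow> bool" where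
  "runs V N a b \<longleftrightarrow> (\<forall>n<N. a n < b n) \<and> (\<forall>n. Suc n < N \<longrightarrow> b n < a (Suc n)) \<and>
     (\<forall>j. V j \<longleftrightarrow> (\<exists>n<N. a n \<le> j \<and> j < b n))"

lemma runs_nonempty: "runs V N a b \<Longrightarrow> n < N \<Longrightarrow> a n < b n"
  by (simp add: runs_def)

lemma runs_iff: "runs V N a b \<Longrightarrow> V j \<longleftrightarrow> (\<exists>n<N. a n \<le> j \<and> j < b n)"
  by (simp add: runs_def)

lemma runs_less:
  assumes r: "runs V N a b" and "Suc k \<le> n" and "n < N"
  shows "b k < a n"
  using assms(2,3)
proof (induction n rule: dec_induct)
  case base
  then show ?case using r by (simp add: runs_def)
next
  case (step n)
  then have "b n < a (Suc n)" "a n < b n" using r by (simp_all add: runs_def)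
  then show ?case using step by simp
qed

lemma runs_less_imp:
  assumes r: "runs V N a b" and "k < N" and "a n < b k" and "n < N"
  shows "n \<le> k"
  using runs_less[OF r, of k n] assms by (meson not_less_eq_eq not_less order.asym)

text \<open>Up to the end of a run the sequence takes a threshold form, here with threshold
  \<open>a 0\<close>; \<open>runs_between\<close> does the same after an earlier run. This is the
  form in which the sweeps over boxes read the state.\<close>

lemma runs_before_first:
  assumes r: "runs V N a b" and "0 < N" and "j < b 0"
  shows "V j \<longleftrightarrow> a 0 \<le> j"
proof
  assume "V j"
  then obtain n where n: "n < N" "a n \<le> j" "j < b n" using runs_iff[OF r] by blast
  then have "n = 0" using runs_less_imp[OF r assms(2), of n] assms(3) by simp
  then show "a 0 \<le> j" using n by simp
qed (use assms runs_iff[OF r] in blast)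

lemma runs_between:
  assumes r: "runs V N a b" and n: "Suc n < N" and j: "b n \<le> j" "j < b (Suc n)"
  shows "V j \<longleftrightarrow> a (Suc n) \<le> j"
proof
  assume "V j"
  then obtain k where k: "k < N" "a k \<le> j" "j < b k" using runs_iff[OF r] by blast
  have "k \<le> Suc n" using runs_less_imp[OF r n, of k] k j by simp
  moreover have "\<not> k \<le> n"
  proof
    assume "k \<le> n"
    moreover have "b k < b n" if "k < n"
      using runs_less[OF r, of k n] runs_nonempty[OF r, of n] that n by simp
    ultimately show False using k j by (cases "k = n") auto
  qed
  ultimately have "k = Suc n" by simp
  then show "a (Suc n) \<le> j" using k by simp
qed (use assms runs_iff[OF r] in blast)

lemma runs_after_last:
  assumes r: "runs V (Suc n) a b" and j: "b n \<le> j"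
  shows "\<not> V j"
proof
  assume "V j"
  then obtain k where k: "k < Suc n" "a k \<le> j" "j < b k" using runs_iff[OF r] by blast
  moreover have "b k < b n" if "k < n"
    using runs_less[OF r, of k n] runs_nonempty[OF r, of n] that by simp
  ultimately show False using j by (cases "k = n") auto
qed

lemma runs_not_end:
  assumes r: "runs V N a b" and n: "n < N"
  shows "\<not> V (b n)"
proof (cases "Suc n < N")
  case True
  then have "b n < a (Suc n)" "a (Suc n) < b (Suc n)" using r by (simp_all add: runs_def)
  then show ?thesis using runs_between[OF r True, of "b n"] by simp
next
  case False
  then have "N = Suc n" using n by simp
  then show ?thesis using runs_after_last[of V n a b] r by simp
qed

lemma runs_not_before:
  assumes r: "runs V N a b" and n: "n < N"
  shows "\<not> V (a n - 1)"
proof (cases n)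
  case 0
  then show ?thesis
    using runs_before_first[OF r, of "a 0 - 1"] runs_nonempty[OF r n] n by simp
next
  case (Suc k)
  then have "b k < a n" using runs_less[OF r, of k n] n by simp
  then show ?thesis
    using runs_between[OF r, of k "a n - 1"] runs_nonempty[OF r n] n Suc by simp
qed

section \<open>Solitons and empty blocks in terms of run end points\<close>

lemma runs_solitons:
  assumes r: "runs V N a b"
  shows "solitons V = (\<lambda>n. {a n..b n - 1}) ` {..<N}"
proof (intro set_eqI iffI)
  fix S assume "S \<in> solitons V"
  then obtain p q where S: "S = {p..q}" and pq: "p \<le> q"
    and V: "\<And>j. p \<le> j \<Longrightarrow> j \<le> q \<Longrightarrow> V j" and p: "\<not> V (p - 1)" and q: "\<not> V (q + 1)"
    unfolding solitons_def by auto
  obtain n where n: "n < N" "a n \<le> p" "p < b n" using V[of p] pq runs_iff[OF r] by auto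
  \<comment> \<open>\<open>S\<close> starts inside run \<open>n\<close>. Starting after
    \<open>a n\<close> would make \<open>p - 1\<close> a one, reaching \<open>b n\<close> would
    include a zero, and ending before \<open>b n - 1\<close> would make \<open>q + 1\<close> a
    one.\<close>
  have "p = a n"
  proof (rule ccontr)
    assume "p \<noteq> a n"
    then have "a n \<le> p - 1" "p - 1 < b n" using n by simp_all
    then have "V (p - 1)" using n(1) runs_iff[OF r] by blast
    then show False using p by simp
  qed
  moreover have "q < b n" using V[of "b n"] n runs_not_end[OF r n(1)] by force
  moreover have "\<not> q + 1 < b n" using q n pq runs_iff[OF r, of "q + 1"] by auto
  ultimately have "S = {a n..b n - 1}" using S by auto
  then show "S \<in> (\<lambda>n. {a n..b n - 1}) ` {..<N}" using n by blast
next
  fix S assume "S \<in> (\<lambda>n. {a n..b n - 1}) ` {..<N}"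
  then obtain n where n: "n < N" and S: "S = {a n..b n - 1}" by auto
  have "\<forall>j\<in>S. V j" using n runs_iff[OF r] unfolding S by auto
  then show "S \<in> solitons V"
    using S n runs_nonempty[OF r n] runs_not_before[OF r n] runs_not_end[OF r n]
    unfolding solitons_def
    by (intro CollectI exI[of _ "a n"] exI[of _ "b n - 1"]) simp
qed

lemma runs_Min:
  assumes r: "runs V N a b" and n: "n < N"
  shows "Min {a n..b n - 1} = a n" and "Max {a n..b n - 1} = b n - 1"
  using runs_nonempty[OF r n] by (auto intro!: Min_eqI Max_eqI)

lemma runs_start_less_iff:
  assumes r: "runs V N a b" and "k < N" and "n < N"
  shows "a k < a n \<longleftrightarrow> k < n"
proof -
  have *: "a i < a j" if "i < j" "j < N" for i j
    using runs_less[OF r, of i j] runs_nonempty[OF r, of i] that by simp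
  show ?thesis using *[of k n] *[of n k] assms by (cases k n rule: linorder_cases) auto
qed

lemma runs_inj:
  assumes r: "runs V N a b"
  shows "inj_on (\<lambda>n. {a n..b n - 1}) {..<N}"
proof (rule inj_onI)
  fix k n assume "k \<in> {..<N}" "n \<in> {..<N}" and eq: "{a k..b k - 1} = {a n..b n - 1}"
  then have kn: "k < N" "n < N" by auto
  have "a k = a n" using runs_Min(1)[OF r kn(1)] runs_Min(1)[OF r kn(2)] eq by simp
  then show "k = n"
    using runs_start_less_iff[OF r kn] runs_start_less_iff[OF r kn(2,1)] by simp
qed

lemma runs_card:
  assumes "runs V N a b"
  shows "card (solitons V) = N"
  unfolding runs_solitons[OF assms] using card_image[OF runs_inj[OF assms]] by simp

text \<open>Starts increase with the index, so the solitons to the left of run \<open>k\<close> are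
  exactly the runs with smaller index, \<open>k\<close> in number by injectivity. The count
  therefore identifies the run.\<close>

lemma runs_soliton:
  assumes r: "runs V N a b" and n: "n < N"
  shows "soliton V n = {a n..b n - 1}"
proof -
  let ?S = "\<lambda>n. {a n..b n - 1}"
  have card: "card {T \<in> solitons V. Min T < Min (?S k)} = k" if k: "k < N" for k
  proof -
    have "{T \<in> solitons V. Min T < Min (?S k)} = ?S ` {..<k}"
      unfolding runs_solitons[OF r]
      using k runs_Min(1)[OF r] runs_start_less_iff[OF r] by auto
    moreover have "inj_on ?S {..<k}" using runs_inj[OF r] k by (auto intro: inj_on_subset)
    ultimately show ?thesis using card_image by fastforce
  qed
  show ?thesis
    unfolding soliton_def
  proof (rule the_equality)
    show "?S n \<in> solitons V \<and> card {T \<in> solitons V. Min T < Min (?S n)} = n"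
      using card[OF n] n runs_solitons[OF r] by blast
  next
    fix S assume S: "S \<in> solitons V \<and> card {T \<in> solitons V. Min T < Min S} = n"
    then obtain k where "k < N" "S = ?S k" unfolding runs_solitons[OF r] by auto
    then show "S = ?S n" using S card by simp
  qed
qed

lemma runs_empty_block:
  assumes r: "runs V N a b" and n: "n \<le> N"
  shows "empty_block V n = {j. (0 < n \<longrightarrow> b (n - 1) \<le> j) \<and> (n < N \<longrightarrow> j < a n)}"
proof -
  have "Max (soliton V (n - 1)) = b (n - 1) - 1" if "0 < n"
    using that n runs_soliton[OF r] runs_Min(2)[OF r, of "n - 1"] by simp
  moreover have "Min (soliton V n) = a n" if "n < N"
    using that runs_soliton[OF r] runs_Min(1)[OF r, of n] by simp
  ultimately show ?thesis unfolding empty_block_def runs_card[OF r] by auto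
qed

text \<open>Induction on \<open>K\<close>: a one at position \<open>K\<close> lengthens the last run
  if that run ends at \<open>K\<close>, and otherwise opens a run of length one. The bound on the
  ends is carried along to guarantee a gap before a newly opened run.\<close>

lemma runs_exist:
  assumes "\<And>j. V j \<Longrightarrow> 0 \<le> j \<and> j < int K"
  shows "\<exists>N a b. runs V N a b \<and> (\<forall>n<N. b n \<le> int K)"
  using assms
proof (induction K arbitrary: V)
  case 0
  then have "runs V 0 a b" for a b unfolding runs_def by force
  then show ?case by blast
next
  case (Suc K)
  define W where "W = (\<lambda>j. V j \<and> j < int K)"
  have "\<And>j. W j \<Longrightarrow> 0 \<le> j \<and> j < int K" using Suc.prems by (auto simp: W_def)
  then obtain N a b where r: "runs W N a b" and b: "\<forall>n<N. b n \<le> int K"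
    using Suc.IH by blast
  have V: "V j \<longleftrightarrow> W j \<or> j = int K \<and> V (int K)" for j
    using Suc.prems[of j] by (cases "j = int K") (auto simp: W_def)
  show ?case
  proof (cases "V (int K)")
    case False
    then have "V = W" using V by (intro ext) blast
    then show ?thesis using r b by (intro exI[of _ N] exI[of _ a] exI[of _ b]) auto
  next
    case VK: True
    show ?thesis
    proof (cases "0 < N \<and> b (N - 1) = int K")
      case True
      then obtain M where M: "N = Suc M" "b M = int K" by (cases N) auto
      have eq: "(\<exists>n<N. a n \<le> j \<and> j < (b(N - 1 := int K + 1)) n) \<longleftrightarrow> V j" for j
      proof -
        have "a M < int K" using runs_nonempty[OF r, of M] M by simp
        then show ?thesis using VK M runs_iff[OF r, of j] unfolding V[of j]
          by (auto simp: less_Suc_eq)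
      qed
      have "runs V N a (b(N - 1 := int K + 1))"
        unfolding runs_def eq using r True runs_nonempty[OF r, of "N - 1"]
        by (auto simp: runs_def)
      moreover have "\<forall>n<N. (b(N - 1 := int K + 1)) n \<le> int (Suc K)" using b by auto
      ultimately show ?thesis by blast
    next
      case False
      have last: "b n < int K" if "N = Suc n" for n
        using False that b by (auto simp: order_less_le)
      have eq: "(\<exists>n<Suc N. (a(N := int K)) n \<le> j \<and> j < (b(N := int K + 1)) n) \<longleftrightarrow> V j" for j
        using runs_iff[OF r, of j] VK unfolding V[of j] by (auto simp: less_Suc_eq)
      have "runs V (Suc N) (a(N := int K)) (b(N := int K + 1))"
        unfolding runs_def eq using r last
        by (auto simp: runs_def less_Suc_eq)
      moreover have "\<forall>n<Suc N. (b(N := int K + 1)) n \<le> int (Suc K)"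
        using b by (auto simp: less_Suc_eq)
      ultimately show ?thesis by blast
    qed
  qed
qed

section \<open>One time step, box by box\<close>

locale box_ball =
  fixes \<Delta> U :: "int \<Rightarrow> int"
  assumes capacity_pos: "0 < \<Delta> n" and state: "bbs_state \<Delta> U"
begin

abbreviation "U' \<equiv> evolve \<Delta> U"
abbreviation "V \<equiv> expand \<Delta> U"
abbreviation "V' \<equiv> expand \<Delta> U'"
abbreviation "s \<equiv> offset \<Delta>"
abbreviation "c \<equiv> carried \<Delta> U"

section \<open>Boxes and their segments\<close>

lemma U_bounds: "0 \<le> U n" "U n \<le> \<Delta> n"
  using state by (auto simp: bbs_state_def)

lemma offset_0: "s 0 = 0"
  by (simp add: offset_def)

lemma carried_0: "c 0 = 0"
  by (simp add: carried_def)

lemma offset_step: "0 \<le> i \<Longrightarrow> s (i + 1) = s i + \<Delta> i"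
  using offset_Suc[of \<Delta> "nat i"] by (simp add: add.commute)

lemma carried_step: "0 \<le> i \<Longrightarrow> c (i + 1) = c i + U i - U' i"
  using carried_Suc[of \<Delta> U "nat i"] by (simp add: add.commute)

lemma offset_less:
  assumes "0 \<le> i" and "i < k"
  shows "s i < s k"
proof -
  have "i + 1 \<le> k" using assms by simp
  then show ?thesis
  proof (induction k rule: int_ge_induct)
    case base
    then show ?case using offset_step[OF assms(1)] capacity_pos[of i] by simp
  next
    case (step k)
    then show ?case using offset_step[of k] capacity_pos[of k] assms by simp
  qed
qed

lemma offset_ge_index: "0 \<le> i \<Longrightarrow> i \<le> s i"
  using offset_ge[of \<Delta> "nat i", OF capacity_pos] by simp

lemma box_exists:
  assumes "0 \<le> j"
  obtains i where "0 \<le> i" and "s i \<le> j" and "j < s (i + 1)"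
proof -
  have "\<exists>i\<ge>0. s i \<le> j \<and> j < s (i + 1)" if "j < s (int k)" for k
    using that
  proof (induction k)
    case 0
    then show ?case using assms by (simp add: offset_0)
  next
    case (Suc k)
    show ?case
    proof (cases "j < s (int k)")
      case False
      then show ?thesis using Suc.prems by (intro exI[of _ "int k"]) (simp add: add.commute)
    qed (use Suc.IH in simp)
  qed
  moreover have "j < s (int (nat (j + 1)))" using offset_ge_index[of "j + 1"] assms by simp
  ultimately show ?thesis using that by blast
qed

lemma box_of_eq:
  assumes "0 \<le> i" and "s i \<le> j" and "j < s (i + 1)"
  shows "box_of \<Delta> j = i"
  unfolding box_of_def
proof (rule the_equality)
  show "0 \<le> i \<and> s i \<le> j \<and> j < s i + \<Delta> i" using assms offset_step by simp
next
  fix k assume k: "0 \<le> k \<and> s k \<le> j \<and> j < s k + \<Delta> k"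
  have "\<not> k < i" using offset_less[of "k + 1" i] offset_step[of k] k assms
    by (cases "k + 1 = i") auto
  moreover have "\<not> i < k" using offset_less[of "i + 1" k] k assms
    by (cases "i + 1 = k") auto
  ultimately show "k = i" by simp
qed

lemma expand_neg: "j < 0 \<Longrightarrow> \<not> V j" "j < 0 \<Longrightarrow> \<not> V' j"
  by (simp_all add: expand_spec(1)[OF capacity_pos])

lemma expand_box:
  assumes "0 \<le> i" and "s i \<le> j" and "j < s (i + 1)"
  shows "expand \<Delta> W j \<longleftrightarrow>
    (if expand \<Delta> W (s i - 1) then j < s i + W i else s (i + 1) - W i \<le> j)"
  using expand_spec(2)[OF capacity_pos, where n = i and j = j and U = W] assms offset_step by simp

lemma expand_bounded: "\<exists>K. \<forall>j. V j \<longrightarrow> 0 \<le> j \<and> j < int K"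
proof -
  have fin: "finite {n. U n \<noteq> 0}" using state by (simp add: bbs_state_def)
  \<comment> \<open>The maximum with 0 keeps \<open>M + 1\<close> a valid box index even without
    balls, when \<open>Max\<close> is applied to the empty set.\<close>
  define M where "M = max 0 (Max {n. U n \<noteq> 0})"
  have M: "n \<le> M" if "U n \<noteq> 0" for n
    using Max_ge[OF fin, of n] that by (simp add: M_def)
  have "0 \<le> j \<and> j < int (nat (s (M + 1)))" if "V j" for j
  proof -
    have j: "0 \<le> j" using expand_neg(1)[of j] that by force
    then obtain i where i: "0 \<le> i" "s i \<le> j" "j < s (i + 1)" by (rule box_exists)
    have "U i \<noteq> 0" using expand_box[OF i, of U] i that by (auto split: if_splits)
    then have "s (i + 1) \<le> s (M + 1)" using M[of i] i(1) offset_less[of "i + 1" "M + 1"]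
      by (cases "i = M") auto
    then show ?thesis using i j by simp
  qed
  then show ?thesis by blast
qed

text \<open>The right-hand side counts the segments of box \<open>i\<close> from \<open>x\<close>
  on, and \<open>U i\<close> is the number of ones in the box. For \<open>x < s i\<close> the box
  follows a one and must be full; otherwise it follows a zero and its ones stand at the right
  end.\<close>

lemma U_of_threshold:
  assumes i: "0 \<le> i"
    and V: "\<And>j. s i - 1 \<le> j \<Longrightarrow> j < s (i + 1) \<Longrightarrow> V j \<longleftrightarrow> x \<le> j"
  shows "U i = max 0 (s (i + 1) - x) - max 0 (s i - x)"
proof -
  note step = offset_step[OF i] and cap = capacity_pos[of i] and U = U_bounds[of i]
  have box: "x \<le> j \<longleftrightarrow> (if x < s i then j < s i + U i else s (i + 1) - U i \<le> j)"
    if "s i \<le> j" "j < s (i + 1)" for j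
    using expand_box[OF i that, of U] V[of j] V[of "s i - 1"] that step cap by (simp split: if_splits)
  have last: "x \<le> s (i + 1) - 1 \<longleftrightarrow>
      (if x < s i then s (i + 1) - 1 < s i + U i else s (i + 1) - U i \<le> s (i + 1) - 1)"
    using box[of "s (i + 1) - 1"] step cap by simp
  show ?thesis
  proof (cases "x < s i")
    case True
    then show ?thesis using last step cap U by simp
  next
    case False
    then show ?thesis
      using last box[of x] box[of "s (i + 1) - U i"] step cap U by (auto split: if_splits)
  qed
qed

text \<open>The invariant of a sweep over boxes that contain no end of a soliton: \<open>x\<close> is the start of the
  next soliton, \<open>p\<close> the start of the new soliton being built, and \<open>d\<close> the number of balls it may
  use.\<close>

lemma sweep:
  assumes k: "0 \<le> k" and d: "0 \<le> d" and p: "p \<le> s k" "p < s k \<or> d = 0" and x: "s k \<le> x"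
    and V'k: "V' (s k - 1) \<longleftrightarrow> p < s k \<and> s k \<le> p + d"
    and ck: "c k = d - min (s k - p) d"
    and "k \<le> i"
    and "\<And>j. s k - 1 \<le> j \<Longrightarrow> j < s i \<Longrightarrow> V j \<longleftrightarrow> x \<le> j"
  shows "c i = d - min (min (s i) x - p) d + max 0 (s i - x)
    \<and> (V' (s i - 1) \<longleftrightarrow> p < s i \<and> s i \<le> min x (p + d))
    \<and> (\<forall>j. s k \<le> j \<and> j < s i \<longrightarrow> (V' j \<longleftrightarrow> j < min x (p + d)))"
  using assms(8,9)
proof (induction i rule: int_ge_induct)
  case base
  then show ?case using x V'k ck by auto
next
  case (step i)
  have i: "0 \<le> i" using step.hyps k by simp
  note off = offset_step[OF i] and cap = capacity_pos[of i] and U = U_bounds[of i]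
  have ki: "s k \<le> s i" using offset_less[OF k, of i] step.hyps by (cases "k = i") auto
  \<comment> \<open>Of the \<open>d\<close> balls, as many have been dropped as there are segments
    from \<open>p\<close> up to \<open>min (s i) x\<close>, but at most \<open>d\<close>. The last
    summand counts the ones of the next soliton collected so far.\<close>
  have IH: "c i = d - min (min (s i) x - p) d + max 0 (s i - x)"
      "V' (s i - 1) \<longleftrightarrow> p < s i \<and> s i \<le> min x (p + d)"
      "\<And>j. s k \<le> j \<Longrightarrow> j < s i \<Longrightarrow> V' j \<longleftrightarrow> j < min x (p + d)"
    using step.IH step.prems off cap by simp_all
  have Ui: "U i = max 0 (s (i + 1) - x) - max 0 (s i - x)"
    using step.prems ki by (intro U_of_threshold[OF i]) simp
  have U'i: "U' i = min (\<Delta> i - U i) (c i)" by (rule evolve_nonneg_index[OF i])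
  have c: "c (i + 1) = d - min (min (s (i + 1)) x - p) d + max 0 (s (i + 1) - x)"
    unfolding carried_step[OF i] U'i Ui IH(1) using off cap ki x p d by (simp add: min_def max_def)
  \<comment> \<open>If the segment before box \<open>i\<close> is a new one, the balls dropped there
    stand at the left end and continue the soliton. Otherwise \<open>U' i = 0\<close>, because the
    carrier is empty or the box is full.\<close>
  have V'i: "V' j \<longleftrightarrow> j < min x (p + d)" if j: "s i \<le> j" "j < s (i + 1)" for j
    unfolding expand_box[OF i j] IH(2) U'i Ui IH(1)
    using off cap ki x p d j by (cases "d = 0") (simp_all add: min_def max_def add.commute split: if_splits)
  have "V' j \<longleftrightarrow> j < min x (p + d)" if "s k \<le> j" "j < s (i + 1)" for j
    using IH(3)[of j] V'i[of j] that by (cases "j < s i") auto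
  moreover have "V' (s (i + 1) - 1) \<longleftrightarrow> p < s (i + 1) \<and> s (i + 1) \<le> min x (p + d)"
    using V'i[of "s (i + 1) - 1"] off cap ki p by auto
  ultimately show ?case using c by blast
qed

text \<open>A box that follows a zero has its zeros before its ones, so the change from one to zero
  at \<open>e\<close> cannot occur there. Hence box \<open>m\<close> follows a one, and its balls
  stand at the left end, up to \<open>e\<close>.\<close>

lemma run_end_box:
  assumes m: "0 \<le> m" "s m \<le> e" "e < s (m + 1)" and e: "V (e - 1)" "\<not> V e"
  shows "V (s m - 1)" and "e = s m + U m" and "\<And>j. e \<le> j \<Longrightarrow> j < s (m + 1) \<Longrightarrow> \<not> V j"
proof -
  show prev: "V (s m - 1)"
  proof (rule ccontr)
    assume *: "\<not> V (s m - 1)"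
    then have "s m \<le> e - 1" using e m by (cases "e = s m") auto
    then show False using * expand_box[OF m(1), of "e - 1" U] expand_box[OF m, of U] m e by simp
  qed
  have "\<not> e < s m + U m" using expand_box[OF m, of U] e prev by simp
  moreover have "e - 1 < s m + U m"
    using expand_box[OF m(1), of "e - 1" U] e prev m U_bounds[of m] by (cases "e = s m") auto
  ultimately show eq: "e = s m + U m" by simp
  show "\<not> V j" if "e \<le> j" "j < s (m + 1)" for j
    using expand_box[OF m(1), of j U] that prev eq m by simp
qed

text \<open>The instance of \<open>sweep\<close> with \<open>k\<close>, \<open>p\<close> and
  \<open>d\<close> all 0; the alternative \<open>d = 0\<close> in its hypotheses is made for this
  case. Boxes up to the start \<open>x\<close> are met with an empty carrier and later ones are
  full, so nothing is dropped before box \<open>m\<close>.\<close>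

lemma first_sweep:
  assumes m: "0 \<le> m" and x: "0 \<le> x" "x < s m"
    and V: "\<And>j. j < s m \<Longrightarrow> V j \<longleftrightarrow> x \<le> j"
  shows "c m = s m - x" and "\<And>j. j < s m \<Longrightarrow> \<not> V' j"
proof -
  have "c m = 0 - min (min (s m) x - 0) 0 + max 0 (s m - x)
    \<and> (V' (s m - 1) \<longleftrightarrow> 0 < s m \<and> s m \<le> min x (0 + 0))
    \<and> (\<forall>j. s 0 \<le> j \<and> j < s m \<longrightarrow> (V' j \<longleftrightarrow> j < min x (0 + 0)))"
    using m x V expand_neg by (intro sweep) (simp_all add: offset_0 carried_0)
  then show "c m = s m - x" "\<And>j. j < s m \<Longrightarrow> \<not> V' j"
    using x expand_neg(2) by (auto simp: offset_0 not_less[symmetric])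
qed

text \<open>With \<open>e\<close> the end of a soliton and \<open>m\<close> the box of segment \<open>e\<close>, the new soliton is
  \<open>[p, min x (p + d))\<close>.\<close>

lemma next_sweep:
  assumes m: "0 \<le> m" "s m \<le> e" "e < s (m + 1)" and e: "V (e - 1)" "\<not> V e"
    and c: "1 \<le> c m" and V'm: "\<not> V' (s m - 1)"
    and d: "d = c m + U m" and p: "p = e + max 0 (\<Delta> m - d)"
    and i: "m + 1 \<le> i" and x: "s (m + 1) \<le> x"
    and V: "\<And>j. e \<le> j \<Longrightarrow> j < s i \<Longrightarrow> V j \<longleftrightarrow> x \<le> j"
  shows "c i = d - min (min (s i) x - p) d + max 0 (s i - x)"
    and "\<And>j. s m \<le> j \<Longrightarrow> j < s i \<Longrightarrow> V' j \<longleftrightarrow> p \<le> j \<and> j < min x (p + d)"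
    and "p < s (m + 1)"
proof -
  note off = offset_step[OF m(1)] and fin = run_end_box[OF m e] and U = U_bounds[of m]
  have U'm: "U' m = min (\<Delta> m - U m) (c m)" by (rule evolve_nonneg_index[OF m(1)])
  \<comment> \<open>Box \<open>m\<close> receives \<open>U' m\<close> new balls. They follow a zero
    and so stand at the right end, which makes \<open>p\<close> their first segment.\<close>
  have pm: "p = s (m + 1) - U' m" using p fin(2) d off U'm by (simp add: min_def max_def)
  have U'_pos: "1 \<le> U' m" using U'm c m fin(2) off by simp
  have box: "V' j \<longleftrightarrow> p \<le> j" if "s m \<le> j" "j < s (m + 1)" for j
    using expand_box[OF m(1), of j U'] that V'm pm by simp
  show "p < s (m + 1)" using pm U'_pos by simp
  \<comment> \<open>With box \<open>m\<close> settled, the sweep starts at box \<open>m + 1\<close>,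
    where \<open>U' m\<close> of the \<open>d\<close> balls are already dropped.\<close>
  have "c i = d - min (min (s i) x - p) d + max 0 (s i - x)
    \<and> (V' (s i - 1) \<longleftrightarrow> p < s i \<and> s i \<le> min x (p + d))
    \<and> (\<forall>j. s (m + 1) \<le> j \<and> j < s i \<longrightarrow> (V' j \<longleftrightarrow> j < min x (p + d)))"
  proof (rule sweep)
    show "V' (s (m + 1) - 1) \<longleftrightarrow> p < s (m + 1) \<and> s (m + 1) \<le> p + d"
      using box[of "s (m + 1) - 1"] pm U'_pos U'm d U off capacity_pos[of m] by auto
    show "c (m + 1) = d - min (s (m + 1) - p) d"
      using carried_step[OF m(1)] pm U'm d U by simp
    show "V j \<longleftrightarrow> x \<le> j" if "s (m + 1) - 1 \<le> j" "j < s i" for j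
      using V[of j] that m by simp
  qed (use m d c U pm U'_pos i x in simp_all)
  then have A: "c i = d - min (min (s i) x - p) d + max 0 (s i - x)"
    and B: "\<And>j. s (m + 1) \<le> j \<Longrightarrow> j < s i \<Longrightarrow> V' j \<longleftrightarrow> j < min x (p + d)" by auto
  show "c i = d - min (min (s i) x - p) d + max 0 (s i - x)" by (rule A)
  show "V' j \<longleftrightarrow> p \<le> j \<and> j < min x (p + d)" if "s m \<le> j" "j < s i" for j
    using B[of j] box[of j] that pm U'_pos U'm d U x by (cases "j < s (m + 1)") auto
qed

section \<open>Solitons after one time step\<close>

context
  fixes N :: nat and a b :: "nat \<Rightarrow> int"
  assumes r: "runs V N a b"
begin

abbreviation "m n \<equiv> empty_box \<Delta> U (Suc n)"
abbreviation "d n \<equiv> carrier_load \<Delta> U n"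

definition "p n = b n + max 0 (empty_capacity \<Delta> U (Suc n) - d n)"
text \<open>One past the predicted last segment of new soliton \<open>n\<close>. The last soliton
  has no successor to stop it, so only the supply \<open>d n\<close> limits its length.\<close>

definition "q n = (if Suc n < N then min (a (Suc n)) (p n + d n) else p n + d n)"

section \<open>Position of the boxes in which solitons end\<close>

lemma start_nonneg:
  assumes "n < N"
  shows "0 \<le> a n"
proof (rule ccontr)
  assume "\<not> 0 \<le> a n"
  then have "\<not> V (a n)" using expand_neg(1) by simp
  then show False using runs_iff[OF r, of "a n"] runs_nonempty[OF r assms] assms by blast
qed

lemma end_in_run:
  assumes "n < N"
  shows "V (b n - 1)"
proof -
  have "a n \<le> b n - 1" "b n - 1 < b n" using runs_nonempty[OF r assms] by simp_all
  then show ?thesis using runs_iff[OF r] assms by blast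
qed

lemma empty_box_bounds:
  assumes n: "n < N"
  shows "0 \<le> m n" "s (m n) \<le> b n" "b n < s (m n + 1)"
proof -
  have "(LEAST j. j \<in> empty_block V (Suc n)) = b n"
    using runs_empty_block[OF r, of "Suc n"] runs_less[OF r, of n "Suc n"] n
    by (intro Least_equality) auto
  moreover obtain i where i: "0 \<le> i" "s i \<le> b n" "b n < s (i + 1)"
    using box_exists[of "b n"] start_nonneg[OF n] runs_nonempty[OF r n] by force
  ultimately have "m n = i" unfolding empty_box_def using box_of_eq[OF i] by simp
  then show "0 \<le> m n" "s (m n) \<le> b n" "b n < s (m n + 1)" using i by simp_all
qed

lemma carrier_load_eq: "d n = c (m n) + U (m n)"
  by (simp add: carrier_load_def Let_def)

lemma p_eq: "p n = b n + max 0 (\<Delta> (m n) - d n)"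
  by (simp add: p_def empty_capacity_def)

lemmas end_box = run_end_box[OF empty_box_bounds end_in_run runs_not_end[OF r]]

text \<open>Box \<open>m (Suc n)\<close> has only ones from its left end up to
  \<open>b (Suc n)\<close>, so the zero at the smaller position \<open>b n\<close> must lie before
  the box.\<close>

lemma end_less_next_box:
  assumes n: "Suc n < N"
  shows "b n < s (m (Suc n))"
proof (rule ccontr)
  assume *: "\<not> b n < s (m (Suc n))"
  have less: "b n < b (Suc n)"
    using runs_less[OF r, of n "Suc n"] runs_nonempty[OF r n] n by simp
  note box = empty_box_bounds[OF n]
  have "\<not> V (b n)" using runs_not_end[OF r] n by simp
  then show False
    using expand_box[OF box(1), of "b n" U] end_box(1,2)[OF n n n n n] * less box by simp
qed

text \<open>The segment just before box \<open>m n\<close> is a one, and it lies beyond the end of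
  any earlier soliton, so it belongs to soliton \<open>n\<close>.\<close>

lemma start_less_box:
  assumes n: "n < N"
  shows "a n < s (m n)"
proof (cases n)
  case 0
  then show ?thesis
    using runs_before_first[OF r, of "s (m 0) - 1"] end_box(1)[of 0] empty_box_bounds[of 0] n
    by simp
next
  case (Suc k)
  then show ?thesis
    using runs_between[OF r, of k "s (m n) - 1"] end_box(1)[of n] empty_box_bounds[of n] n
      end_less_next_box[of k] by simp
qed

lemma box_mono:
  assumes n: "Suc n < N"
  shows "m n + 1 \<le> m (Suc n)"
proof (rule ccontr)
  assume "\<not> m n + 1 \<le> m (Suc n)"
  then have "s (m (Suc n)) \<le> s (m n)"
    using offset_less[of "m (Suc n)" "m n"] empty_box_bounds(1)[OF n]
    by (cases "m (Suc n) = m n") auto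
  then show False using end_less_next_box[OF n] empty_box_bounds(2)[of n] n by simp
qed

text \<open>From \<open>b n\<close> to the end of its box there are only zeros, so the next soliton
  starts in a later box.\<close>

lemma box_end_le_start:
  assumes n: "Suc n < N"
  shows "s (m n + 1) \<le> a (Suc n)"
proof (rule ccontr)
  assume "\<not> s (m n + 1) \<le> a (Suc n)"
  then have "\<not> V (a (Suc n))" using end_box(3)[of n "a (Suc n)"] runs_less[OF r, of n "Suc n"] n by simp
  then show False using runs_iff[OF r, of "a (Suc n)"] runs_nonempty[OF r n] n by blast
qed

lemma q_le: "k < n \<Longrightarrow> n < N \<Longrightarrow> q k \<le> a n"
  using runs_start_less_iff[OF r, of "Suc k" n] by (cases "Suc k = n") (auto simp: q_def)

section \<open>Induction along the solitons\<close>

lemma before_first_box: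
  assumes N: "0 < N"
  shows "c (m 0) = s (m 0) - a 0" and "\<And>j. j < s (m 0) \<Longrightarrow> \<not> V' j"
proof -
  have "V j \<longleftrightarrow> a 0 \<le> j" if "j < s (m 0)" for j
    using runs_before_first[OF r N] empty_box_bounds(2)[OF N] that by simp
  note * = first_sweep[OF empty_box_bounds(1)[OF N] start_nonneg[OF N] start_less_box[OF N] this]
  show "c (m 0) = s (m 0) - a 0" by (rule *(1))
  show "\<And>j. j < s (m 0) \<Longrightarrow> \<not> V' j" by (rule *(2))
qed

lemma carrier_load_0: "0 < N \<Longrightarrow> d 0 = b 0 - a 0"
  using before_first_box(1) end_box(2)[of 0] carrier_load_eq[of 0] by simp

text \<open>This is \<open>next_sweep\<close> with \<open>x = a (Suc n)\<close>, taken up to the box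
  in which soliton \<open>Suc n\<close> ends. The third claim leaves room for at least one ball of
  the new soliton.\<close>

lemma between_boxes:
  assumes n: "Suc n < N" and c: "1 \<le> c (m n)" and V'm: "\<not> V' (s (m n) - 1)"
  shows "c (m (Suc n)) = d n - (q n - p n) + (s (m (Suc n)) - a (Suc n))"
    and "\<And>j. s (m n) \<le> j \<Longrightarrow> j < s (m (Suc n)) \<Longrightarrow> V' j \<longleftrightarrow> p n \<le> j \<and> j < q n"
    and "p n < a (Suc n)"
proof -
  have n': "n < N" using n by simp
  have V: "V j \<longleftrightarrow> a (Suc n) \<le> j" if "b n \<le> j" "j < s (m (Suc n))" for j
    using runs_between[OF r n] empty_box_bounds(2)[OF n] that by simp
  note * = next_sweep[OF empty_box_bounds[OF n'] end_in_run[OF n'] runs_not_end[OF r n'] c V'm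
      carrier_load_eq p_eq box_mono[OF n] box_end_le_start[OF n] V]
  show "c (m (Suc n)) = d n - (q n - p n) + (s (m (Suc n)) - a (Suc n))"
    using *(1) start_less_box[OF n] n by (simp add: q_def min_def max_def split: if_splits)
  show "V' j \<longleftrightarrow> p n \<le> j \<and> j < q n" if "s (m n) \<le> j" "j < s (m (Suc n))" for j
    using *(2)[OF _ _ that] n by (simp add: q_def)
  show "p n < a (Suc n)" using *(3) box_end_le_start[OF n] by simp
qed

lemma after_last_box:
  assumes N: "N = Suc n" and c: "1 \<le> c (m n)" and V'm: "\<not> V' (s (m n) - 1)"
    and j: "s (m n) \<le> j"
  shows "V' j \<longleftrightarrow> p n \<le> j \<and> j < q n"
proof -
  \<comment> \<open>With no further soliton, the threshold is placed at \<open>s i\<close>, the end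
    of the swept region. Choosing \<open>i\<close> beyond \<open>j\<close> puts segment
    \<open>j\<close> inside that region and makes the cut at \<open>s i\<close> irrelevant for
    it.\<close>
  define i where "i = max (m n + 1) (j + 1)"
  have n: "n < N" using N by simp
  have i1: "m n + 1 \<le> i" "j + 1 \<le> i" by (simp_all add: i_def)
  then have i: "m n + 1 \<le> i" "j < s i"
    using offset_ge_index[of i] empty_box_bounds(1)[OF n] by simp_all
  have "s (m n + 1) \<le> s i"
    using offset_less[of "m n + 1" i] i(1) empty_box_bounds(1)[OF n]
    by (cases "m n + 1 = i") auto
  moreover have "V k \<longleftrightarrow> s i \<le> k" if "b n \<le> k" "k < s i" for k
    using runs_after_last[of V n a b k] r N that by simp
  ultimately have "V' j \<longleftrightarrow> p n \<le> j \<and> j < min (s i) (p n + d n)"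
    using next_sweep(2)[OF empty_box_bounds[OF n] end_in_run[OF n] runs_not_end[OF r n] c V'm
      carrier_load_eq p_eq i(1) _ _ j i(2)] by blast
  moreover have "\<not> Suc n < N" using N by simp
  then have "q n = p n + d n" by (simp add: q_def)
  ultimately show ?thesis using i(2) by simp
qed

text \<open>The first two claims are what \<open>between_boxes\<close> requires in order to advance
  from box \<open>m n\<close> to box \<open>m (Suc n)\<close>; the third accumulates the new
  solitons met on the way.\<close>

lemma before_box:
  assumes "n < N"
  shows "1 \<le> c (m n) \<and> \<not> V' (s (m n) - 1) \<and>
    (\<forall>j<s (m n). V' j \<longleftrightarrow> (\<exists>k<n. p k \<le> j \<and> j < q k))"
  using assms
proof (induction n)
  case 0
  then show ?case using before_first_box start_less_box[of 0] by simp
next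
  case (Suc n)
  then have n: "Suc n < N" and n': "n < N" by simp_all
  then have c: "1 \<le> c (m n)" and V'm: "\<not> V' (s (m n) - 1)"
    and IH: "\<And>j. j < s (m n) \<Longrightarrow> V' j \<longleftrightarrow> (\<exists>k<n. p k \<le> j \<and> j < q k)"
    using Suc.IH by blast+
  note between = between_boxes[OF n c V'm]
  have qn: "q n \<le> a (Suc n)" "q n - p n \<le> d n" using n by (simp_all add: q_def)
  have p: "s (m n) \<le> p n" using empty_box_bounds(2)[of n] n by (simp add: p_def)
  have "s (m n) < s (m (Suc n))"
    using offset_less box_mono[OF n] empty_box_bounds(1)[of n] n by simp
  \<comment> \<open>The new soliton stops at \<open>a (Suc n)\<close> at the latest, which is at or
    before the segment preceding box \<open>m (Suc n)\<close>.\<close>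
  then have last: "\<not> V' (s (m (Suc n)) - 1)"
    using between(2)[of "s (m (Suc n)) - 1"] qn start_less_box[OF n] by simp
  have iff: "V' j \<longleftrightarrow> (\<exists>k<Suc n. p k \<le> j \<and> j < q k)" if j: "j < s (m (Suc n))" for j
  proof (cases "j < s (m n)")
    case True
    then show ?thesis using IH[of j] p by (auto simp: less_Suc_eq)
  next
    case False
    have "\<not> j < q k" if "k < n" for k
      using q_le[OF that] start_less_box[of n] n False by force
    then show ?thesis using between(2)[of j] False j by (auto simp: less_Suc_eq)
  qed
  \<comment> \<open>At least one ball of soliton \<open>Suc n\<close> lies before its end box and is
    on the carrier by then.\<close>
  have "1 \<le> c (m (Suc n))" using between(1) qn start_less_box[OF n] by simp
  then show ?case using last iff by blast
qed

text \<open>The carrier arrives with what is left of \<open>d n\<close> and the ones from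
  \<open>a (Suc n)\<close> to the box boundary; the balls of box \<open>m (Suc n)\<close> supply the
  ones from there to \<open>b (Suc n)\<close>.\<close>

lemma carrier_load_Suc:
  assumes "Suc n < N"
  shows "d (Suc n) = d n - (q n - p n) + (b (Suc n) - a (Suc n))"
proof -
  have "1 \<le> c (m n)" "\<not> V' (s (m n) - 1)" using before_box[of n] Suc_lessD[OF assms] by blast+
  then show ?thesis
    using between_boxes(1)[OF assms] end_box(2)[of "Suc n"] carrier_load_eq[of "Suc n"] assms
    by simp
qed

lemma runs_evolve:
  assumes N: "0 < N"
  shows "runs V' N p q"
  unfolding runs_def
proof (intro conjI allI impI)
  fix n assume n: "n < N"
  have c: "1 \<le> c (m n)" and V'm: "\<not> V' (s (m n) - 1)" using before_box[OF n] by blast+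
  have "1 \<le> d n" using c carrier_load_eq U_bounds[of "m n"] by simp
  then show "p n < q n" using between_boxes(3)[of n] c V'm by (simp add: q_def)
next
  fix n assume n: "Suc n < N"
  \<comment> \<open>Old soliton \<open>Suc n\<close> separates the new ones: new soliton
    \<open>n\<close> stops no later than its start, and the next begins no earlier than its
    end.\<close>
  have "q n \<le> a (Suc n)" using n by (simp add: q_def)
  also have "\<dots> < b (Suc n)" using runs_nonempty[OF r n] .
  also have "\<dots> \<le> p (Suc n)" by (simp add: p_def)
  finally show "q n < p (Suc n)" .
next
  fix j
  obtain n where n: "N = Suc n" using N by (cases N) auto
  then have n': "n < N" by simp
  have c: "1 \<le> c (m n)" and V'm: "\<not> V' (s (m n) - 1)"
    and before: "\<And>j. j < s (m n) \<Longrightarrow> V' j \<longleftrightarrow> (\<exists>k<n. p k \<le> j \<and> j < q k)"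
    using before_box[OF n'] by blast+
  have p: "s (m n) \<le> p n" using empty_box_bounds(2)[of n] n by (simp add: p_def)
  show "V' j \<longleftrightarrow> (\<exists>k<N. p k \<le> j \<and> j < q k)"
  proof (cases "j < s (m n)")
    case True
    then have "\<not> p n \<le> j" using p by simp
    then show ?thesis using before[OF True] n less_Suc_eq by metis
  next
    case False
    have "\<not> j < q k" if "k < n" for k
      using q_le[OF that] start_less_box[of n] n False by force
    then show ?thesis using after_last_box[OF n c V'm, of j] False n less_Suc_eq
      by (metis not_less)
  qed
qed

end

end

section \<open>Sizes of solitons and empty blocks\<close>

lemma runs_soliton_size:
  assumes "runs (expand \<Delta> U) N a b" and "n < N"
  shows "soliton_size \<Delta> U n = b n - a n"
  using runs_soliton[OF assms] runs_nonempty[OF assms] by (simp add: soliton_size_def)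

lemma runs_empty_size:
  assumes r: "runs (expand \<Delta> U) N a b" and n: "1 \<le> n" "n < N"
  shows "empty_size \<Delta> U n = ereal (real_of_int (a n - b (n - 1)))"
proof -
  have "empty_block (expand \<Delta> U) n = {b (n - 1)..<a n}"
    unfolding runs_empty_block[OF r less_imp_le[OF n(2)]] using n by auto
  moreover have "b (n - 1) < a n" using runs_less[OF r, of "n - 1" n] n by simp
  ultimately show ?thesis by (simp add: empty_size_def)
qed

text \<open>Each outer block contains a half-line.\<close>

lemma runs_empty_size_outer:
  assumes r: "runs (expand \<Delta> U) N a b" and n: "n = 0 \<or> n = N"
  shows "empty_size \<Delta> U n = \<infinity>"
proof -
  have "{..<a 0} \<subseteq> empty_block (expand \<Delta> U) n \<or> {b (N - 1)..} \<subseteq> empty_block (expand \<Delta> U) n"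
    using n runs_empty_block[OF r le0] runs_empty_block[OF r order_refl] by (elim disjE) auto
  then have "infinite (empty_block (expand \<Delta> U) n)"
    using infinite_Iio[of "a 0"] infinite_Ici[of "b (N - 1)"] finite_subset by blast
  then show ?thesis by (simp add: empty_size_def)
qed

theorem theorem2:
  fixes \<Delta> U U' :: "int \<Rightarrow> int"
    and N :: nat
    and Q Q' D \<Lambda> :: "nat \<Rightarrow> int"
    and E E' :: "nat \<Rightarrow> ereal"
  assumes "\<And>n. 0 < \<Delta> n"
    and "bbs_state \<Delta> U"
    and "U' = evolve \<Delta> U"
    and "N = num_solitons \<Delta> U" and "1 \<le> N"
    and "Q = soliton_size \<Delta> U" and "Q' = soliton_size \<Delta> U'"
    and "E = empty_size \<Delta> U" and "E' = empty_size \<Delta> U'"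
    and "D = carrier_load \<Delta> U"
    and "\<Lambda> = empty_capacity \<Delta> U"
  shows "num_solitons \<Delta> U' = N \<and>
    (\<forall>n\<in>{0..N - 1}.
      ereal (real_of_int (Q' n)) =
        min (E (n + 1) - ereal (real_of_int (max 0 (\<Lambda> (n + 1) - D n))))
            (ereal (real_of_int (D n)))) \<and>
    (\<forall>n\<in>{1..N - 1}.
      E' n = E n - ereal (real_of_int (Q' (n - 1))) + ereal (real_of_int (Q n))
        - ereal (real_of_int (max 0 (\<Lambda> n - D (n - 1))))
        + ereal (real_of_int (max 0 (\<Lambda> (n + 1) - D n)))) \<and>
    (\<forall>n\<in>{1..N - 1}. D n = D (n - 1) - Q' (n - 1) + Q n) \<and>
    E 0 = \<infinity> \<and> E N = \<infinity> \<and> D 0 = Q 0"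
proof -
  interpret box_ball \<Delta> U using assms(1,2) by unfold_locales
  obtain N' a b where r': "runs (expand \<Delta> U) N' a b"
    using expand_bounded runs_exist[of "expand \<Delta> U"] by blast
  have "N' = N" using runs_card[OF r'] assms(4) by (simp add: num_solitons_def)
  then have r: "runs (expand \<Delta> U) N a b" using r' by simp
  have N: "0 < N" using assms(5) by simp
  define p' q' where "p' = p b" and "q' = q N a b"
  have r2: "runs (expand \<Delta> U') N p' q'"
    unfolding assms(3) p'_def q'_def by (rule runs_evolve[OF r N])
  have p': "p' n = b n + max 0 (\<Lambda> (Suc n) - D n)" for n
    by (simp add: p'_def p_def[OF r] assms(10,11))
  have q': "q' n = (if Suc n < N then min (a (Suc n)) (p' n + D n) else p' n + D n)" for n
    by (simp add: p'_def q'_def q_def[OF r] assms(10))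
  have Q: "Q n = b n - a n" if "n < N" for n
    using runs_soliton_size[OF r that] assms(6) by simp
  have Q': "Q' n = q' n - p' n" if "n < N" for n
    using runs_soliton_size[OF r2 that] assms(7) by simp
  have E: "E n = ereal (real_of_int (a n - b (n - 1)))" if "1 \<le> n" "n < N" for n
    using runs_empty_size[OF r that] assms(8) by simp
  have E': "E' n = ereal (real_of_int (p' n - q' (n - 1)))" if "1 \<le> n" "n < N" for n
    using runs_empty_size[OF r2 that] assms(9) by simp
  have E_outer: "E 0 = \<infinity>" "E N = \<infinity>"
    using runs_empty_size_outer[OF r] assms(8) by simp_all
  have D0: "D 0 = Q 0" using carrier_load_0[OF r N] Q N assms(10) by simp
  have D: "D n = D (n - 1) - Q' (n - 1) + Q n" if "n \<in> {1..N - 1}" for n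
  proof -
    have n: "Suc (n - 1) = n" "n < N" "n - 1 < N" using that by auto
    show ?thesis
      using carrier_load_Suc[OF r, of "n - 1"] Q[OF n(2)] Q'[OF n(3)] n assms(10)
      by (simp add: p'_def q'_def)
  qed
  have Q'_eq: "ereal (real_of_int (Q' n)) =
      min (E (n + 1) - ereal (real_of_int (max 0 (\<Lambda> (n + 1) - D n)))) (ereal (real_of_int (D n)))"
    if "n \<in> {0..N - 1}" for n
  proof (cases "Suc n < N")
    case True
    then show ?thesis using Q'[of n] E[of "Suc n"] q'[of n] p'[of n]
      by (simp add: min_def max_def)
  next
    \<comment> \<open>For the last soliton \<open>E N = \<infinity>\<close>, so the minimum is
      \<open>D n\<close>, the length \<open>q' n - p' n\<close> in the second case of
      \<open>q'\<close>.\<close>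
    case False
    then have "Suc n = N" using that N by simp
    then show ?thesis using Q'[of n] E_outer q'[of n] by simp
  qed
  have E'_eq: "E' n = E n - ereal (real_of_int (Q' (n - 1))) + ereal (real_of_int (Q n))
        - ereal (real_of_int (max 0 (\<Lambda> n - D (n - 1))))
        + ereal (real_of_int (max 0 (\<Lambda> (n + 1) - D n)))" if "n \<in> {1..N - 1}" for n
  proof -
    have n: "1 \<le> n" "n < N" "n - 1 < N" "Suc (n - 1) = n" using that by auto
    \<comment> \<open>An identity over the integers: \<open>q' (n - 1)\<close> is
      \<open>p' (n - 1) + Q' (n - 1)\<close>, both starts expand by \<open>p'\<close>, and
      \<open>b n\<close> is \<open>a n + Q n\<close>.\<close>
    have "p' n - q' (n - 1) = a n - b (n - 1) - Q' (n - 1) + Q n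
        - max 0 (\<Lambda> n - D (n - 1)) + max 0 (\<Lambda> (n + 1) - D n)"
      using Q[OF n(2)] Q'[OF n(3)] p'[of n] p'[of "n - 1"] n(4) by simp
    then show ?thesis unfolding E'[OF n(1,2)] E[OF n(1,2)] by simp
  qed
  have "num_solitons \<Delta> U' = N" using runs_card[OF r2] by (simp add: num_solitons_def)
  then show ?thesis using Q'_eq E'_eq D E_outer D0 by blast
qed

end
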